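(* Let $n\ge 1$ be an integer and let $D_M>0$. There exist finite constants $C_1,C_2$, depending only on $n$ and $D_M$, such that the following holds. Let $M:[0,\infty)\to[0,\infty)$ be an increasing and convex function with $M(0)=0$ such that $M(\alpha x)\le \alpha^{D_M}M(x)$ for all $\alpha\ge 1$, $x\ge 0$. Then for every continuous, piecewise $C^1$ function $u:[0,\infty)\to\mathbb{R}$, $$\int_0^\infty M(r|u(r)|)\,d\mu_n(r)\le C_1\int_0^\infty M(|u(r)|)\,d\mu_n(r)+C_2\int_0^\infty M(|u'(r)|)\,d\mu_n(r).$$
   Context: For an integer $n\ge 1$, $\mu_n$ is the measure on $[0,\infty)$ given by $d\mu_n(r)=r^{n-1}e^{-r^2/2}\,dr$. Integrals of nonnegative functions take values in $[0,+\infty]$. *)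

theory Defs
  imports "HOL-Analysis.Analysis"
begin

definition gauss_radial_measure :: "nat \<Rightarrow> real measure" where
  "gauss_radial_measure n =
     density (restrict_space lborel {0..}) (\<lambda>r. ennreal (r ^ (n - 1) * exp (- (r\<^sup>2) / 2)))"

(* On an unbounded interval the break points are only required to be finite in number on each
   bounded subinterval.  The library notion uses two-sided derivatives off a finite set, but 0 may
   be put in that set, so values of u on the negative half-line are irrelevant. *)
definition piecewise_C1_halfline :: "(real \<Rightarrow> real) \<Rightarrow> bool" where
  "piecewise_C1_halfline u \<longleftrightarrow> (\<forall>R>0. u piecewise_C1_differentiable_on {0..R})"

end

theory Submission
  imports Defs
begin

text \<open>
  The weight \<open>w r = r ^ (n - 1) * exp (- r\<^sup>2 / 2)\<close> satisfies
  \<open>(w / r)' = w * ((n - 2) / r\<^sup>2 - 1)\<close>, that is, \<open>w\<close> is minus the derivative of \<open>w / r\<close> up to a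
  relative error of order \<open>1 / r\<^sup>2\<close>.  Hence \<open>\<integral> M (r \<bar>u\<bar>) w\<close> can be integrated by parts over a
  tail \<open>[a, \<infinity>)\<close>: the boundary term at infinity has the favourable sign, and the
  derivative of \<open>M (r \<bar>u\<bar>)\<close> produces a term like \<open>M (r \<bar>u\<bar>) / r\<^sup>2\<close>, which the left-hand side
  absorbs, and a term like \<open>M (r \<bar>u\<bar>) \<bar>u'\<bar> / \<bar>u\<bar>\<close> against the weight \<open>w / r\<close>, which a Young-type
  inequality (\<open>young_inequality\<close>) splits into an absorbable part and a multiple of \<open>M \<bar>u'\<bar>\<close>.
  The boundary term at \<open>a\<close> is controlled by choosing \<open>a\<close> well in an interval of length one, and on
  the bounded range \<open>r \<le> a\<close> the growth condition gives \<open>M (r \<bar>u\<bar>) \<le> K M \<bar>u\<bar>\<close> at once.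

  Two regularizations make this rigorous.  First, \<open>M\<close> need not be differentiable; it is
  replaced by its mean value \<open>N x = (\<integral>\<^sub>0\<^sup>x M) / x\<close>, which is comparable with \<open>M\<close> and satisfies
  the exact identity \<open>x N' x = M x - N x\<close>.  Second, \<open>\<bar>u\<bar>\<close> need not be differentiable at the zeros of
  \<open>u\<close>; it is replaced by \<open>v = sqrt (u\<^sup>2 + \<epsilon>\<^sup>2)\<close>, which is positive and satisfies \<open>\<bar>v'\<bar> \<le> \<bar>u'\<bar>\<close>.
  Since the measure is finite, \<open>\<epsilon>\<close> can be sent to zero at the end.  The analytic core is
  \<open>energy_bound\<close>, the pointwise differential inequality for \<open>N (r v) w / r\<close>.
\<close>

section \<open>Doubling Young functions\<close>

text \<open>
  The constants of the proof.  The running mean of \<open>M\<close> is at least \<open>average_const D\<close> times \<open>M\<close>; a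
  quarter of that constant is the amount that each of the two error terms in the integration by parts may
  consume, and this fixes the other two constants: \<open>young_const\<close> is the price of the term with
  \<open>u'\<close> in the Young-type inequality with parameter \<open>average_const D / 4\<close>, and beyond \<open>tail_radius\<close>
  one has \<open>(n + 1) / r\<^sup>2 \<le> average_const D / 4\<close>.
\<close>

definition average_const :: "real \<Rightarrow> real" where
  "average_const D = 2 powr (- D) / 2"

definition young_const :: "real \<Rightarrow> real" where
  "young_const D = average_const D / 4 * (4 / average_const D) powr D"

definition tail_radius :: "real \<Rightarrow> nat \<Rightarrow> real" where
  "tail_radius D n = 4 * (real n + 1) / average_const D"

lemma average_const_pos: "0 < average_const D"
  by (simp add: average_const_def)

lemma average_const_le_1:
  assumes "0 < D"
  shows "average_const D \<le> 1"
proof -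
  have "2 powr (- D) \<le> 2 powr (0::real)"
    using assms by (intro powr_mono) auto
  then show ?thesis by (simp add: average_const_def)
qed

lemma tail_radius_ge:
  assumes "0 < D"
  shows "4 \<le> tail_radius D n"
  using average_const_pos[of D] average_const_le_1[OF assms] by (simp add: tail_radius_def field_simps)

locale doubling_young_function =
  fixes M :: "real \<Rightarrow> real" and D :: real
  assumes exponent_pos: "0 < D"
    and nonneg: "0 \<le> x \<Longrightarrow> 0 \<le> M x"
    and mono: "mono_on {0..} M"
    and convex: "convex_on {0..} M"
    and zero: "M 0 = 0"
    and growth: "1 \<le> \<alpha> \<Longrightarrow> 0 \<le> x \<Longrightarrow> M (\<alpha> * x) \<le> \<alpha> powr D * M x"
begin

lemma le: "0 \<le> x \<Longrightarrow> x \<le> y \<Longrightarrow> M x \<le> M y"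
  using mono by (auto simp: mono_on_def)

lemma star_shaped:
  assumes "0 \<le> t" "t \<le> 1" "0 \<le> y"
  shows "M (t * y) \<le> t * M y"
  using convex_onD[OF convex, of t 0 y] assms zero by simp

lemma slope_le:
  assumes "0 < x" "x \<le> y"
  shows "M x / x \<le> M y / y"
  using star_shaped[of "x / y" y] assms by (simp add: field_simps)

text \<open>
  Convexity gives continuity in the open half-line only; at \<open>0\<close> it follows from
  \<open>0 \<le> M x \<le> x M 1\<close>.
\<close>

lemma continuous: "continuous_on {0..} M"
proof -
  have inner: "continuous_on {0<..} M"
    by (rule convex_on_continuous) (auto intro: convex_on_subset[OF convex])
  have "(M \<longlongrightarrow> M 0) (at 0 within {0..})"
    unfolding zero
  proof (rule tendsto_sandwich[of "\<lambda>_. 0" _ _ "\<lambda>x. x * M 1"])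
    show "\<forall>\<^sub>F x in at 0 within {0..}. 0 \<le> M x"
      by (auto simp: eventually_at_filter nonneg)
    have "\<forall>\<^sub>F x in at 0 within {0..}. x < (1::real)"
      by (intro order_tendstoD(2)[of "\<lambda>x. x" 0]) (auto intro: tendsto_eq_intros)
    moreover have "\<forall>\<^sub>F x in at 0 within {0..}. (0::real) \<le> x"
      by (auto simp: eventually_at_filter)
    ultimately show "\<forall>\<^sub>F x in at 0 within {0..}. M x \<le> x * M 1"
      by eventually_elim (use star_shaped[of _ 1] in auto)
    show "((\<lambda>x. x * M 1) \<longlongrightarrow> 0) (at 0 within {0..})"
      by (auto intro!: tendsto_eq_intros)
  qed auto
  moreover have "(M \<longlongrightarrow> M x) (at x within {0..})" if "0 < x" for x
  proof -
    have "isCont M x"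
      using inner that by (simp add: continuous_on_eq_continuous_at)
    then show ?thesis
      by (auto simp: isCont_def intro: tendsto_within_subset)
  qed
  ultimately show ?thesis
    unfolding continuous_on_def by (metis atLeast_iff order_le_less)
qed

lemma continuous_abs: "continuous_on A f \<Longrightarrow> continuous_on A (\<lambda>x. M \<bar>f x\<bar>)"
  by (intro continuous_on_compose2[OF continuous]) (auto intro: continuous_intros)

lemma measurable_abs[measurable]: "(\<lambda>x. M \<bar>x\<bar>) \<in> borel_measurable borel"
  by (intro borel_measurable_continuous_onI continuous_abs continuous_intros)

lemma add_le:
  assumes "0 \<le> x" "0 \<le> y"
  shows "M (x + y) \<le> 2 powr D * (M x + M y)"
proof -
  have *: "M (x + y) \<le> 2 powr D * M (max x y)"
  proof -
    have "0 \<le> max x y" "x + y \<le> 2 * max x y" using assms by auto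
    then show ?thesis
      using le[of "x + y" "2 * max x y"] growth[of 2 "max x y"] assms by linarith
  qed
  also have "M (max x y) \<le> M x + M y"
    using nonneg[OF assms(1)] nonneg[OF assms(2)] by (auto simp: max_def)
  finally show ?thesis by simp
qed

text \<open>
  The running mean is a differentiable substitute for \<open>M\<close>.
\<close>

definition average :: "real \<Rightarrow> real" where
  "average x = integral {0..x} M / x"

abbreviation "\<kappa> \<equiv> average_const D"

lemma integrable: "0 \<le> a \<Longrightarrow> M integrable_on {a..b}"
  by (rule integrable_continuous_real, rule continuous_on_subset[OF continuous]) auto

lemma average_le:
  assumes "0 < x"
  shows "average x \<le> M x"
proof -
  have "integral {0..x} M \<le> integral {0..x} (\<lambda>_. M x)"
    by (intro integral_le integrable) (auto intro: le)
  then show ?thesis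
    using assms by (simp add: average_def field_simps)
qed

lemma average_nonneg: "0 < x \<Longrightarrow> 0 \<le> average x"
  unfolding average_def
  by (intro divide_nonneg_pos integral_nonneg integrable) (auto intro: nonneg)

text \<open>
  The upper half \<open>[x/2, x]\<close> of the interval alone contributes \<open>M (x / 2) / 2\<close> to the mean, and
  \<open>M (x / 2)\<close> is comparable with \<open>M x\<close> by the growth condition.
\<close>

lemma average_ge:
  assumes "0 < x"
  shows "\<kappa> * M x \<le> average x"
proof -
  have "M x \<le> 2 powr D * M (x / 2)"
    using growth[of 2 "x / 2"] assms by simp
  then have "2 powr (- D) * M x \<le> M (x / 2)"
    by (simp add: powr_minus field_simps)
  moreover have "M (x / 2) * (x / 2) = integral {x/2..x} (\<lambda>_. M (x / 2))"
    using assms by simp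
  moreover have "\<dots> \<le> integral {x/2..x} M"
    using assms by (intro integral_le integrable) (auto intro: le)
  moreover have "\<dots> \<le> integral {0..x} M"
    using assms by (intro integral_subset_le integrable) (auto intro: nonneg)
  ultimately have "2 powr (- D) * M x * (x / 2) \<le> integral {0..x} M"
    using mult_right_mono[of "2 powr (- D) * M x" "M (x / 2)" "x / 2"] assms by linarith
  then show ?thesis
    using assms by (simp add: average_def average_const_def field_simps)
qed

lemma average_deriv:
  assumes "0 < x"
  shows "(average has_real_derivative (M x - average x) / x) (at x)"
proof -
  have "((\<lambda>x. integral {0..x} M) has_real_derivative M x) (at x within {0..2*x})"
    using assms by (intro integral_has_real_derivative continuous_on_subset[OF continuous]) auto
  then have I: "((\<lambda>x. integral {0..x} M) has_real_derivative M x) (at x)"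
    using assms by (subst (asm) at_within_interior) auto
  have "((\<lambda>x. integral {0..x} M / x) has_real_derivative
          (M x * x - integral {0..x} M * 1) / (x * x)) (at x)"
    using assms by (intro DERIV_divide I DERIV_ident) auto
  then show ?thesis
    using assms unfolding average_def[abs_def]
    by (rule_tac DERIV_cong) (auto simp: field_simps)
qed

text \<open>
  Either \<open>p \<le> \<delta> a\<close>, and then the left-hand side is at most \<open>\<delta> M a\<close>; or \<open>a < p / \<delta>\<close>, and then, since the
  slope \<open>M x / x\<close> increases, \<open>a\<close> may be replaced by \<open>p / \<delta>\<close>, from which the growth condition
  removes the factor \<open>1 / \<delta>\<close>.
\<close>

lemma young_inequality:
  assumes "0 < \<delta>" "\<delta> \<le> 1" "0 < a" "0 \<le> p"
  shows "M a * p / a \<le> \<delta> * M a + \<delta> * (1 / \<delta>) powr D * M p"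
proof (cases "p \<le> \<delta> * a")
  case True
  then have "M a * p / a \<le> M a * (\<delta> * a) / a"
    using assms by (intro divide_right_mono mult_left_mono) (auto intro: nonneg)
  also have "\<dots> = \<delta> * M a"
    using assms by simp
  finally show ?thesis
    using nonneg[OF assms(4)] assms(1) by (smt (verit) mult_nonneg_nonneg powr_ge_zero)
next
  case False
  define b where "b = 1 / \<delta> * p"
  have b: "a \<le> b" "p = \<delta> * b"
    using False assms by (auto simp: b_def field_simps)
  have "M a * p / a = p * (M a / a)"
    by simp
  also have "\<dots> \<le> p * (M b / b)"
    using slope_le[of a b] assms b by (intro mult_left_mono) auto
  also have "\<dots> = \<delta> * M b"
    using b assms by simp
  also have "\<dots> \<le> \<delta> * ((1 / \<delta>) powr D * M p)"
    using growth[of "1 / \<delta>" p] assms unfolding b_def by (intro mult_left_mono) auto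
  finally show ?thesis
    using nonneg[of a] assms by (smt (verit) mult.assoc mult_nonneg_nonneg)
qed

end

section \<open>The Gaussian weight\<close>

definition gauss_weight :: "nat \<Rightarrow> real \<Rightarrow> real" where
  "gauss_weight n r = r ^ (n - 1) * exp (- (r\<^sup>2) / 2)"

lemma gauss_weight_nonneg: "0 \<le> r \<Longrightarrow> 0 \<le> gauss_weight n r"
  by (simp add: gauss_weight_def)

lemma gauss_weight_deriv:
  assumes "1 \<le> n" "0 < r"
  shows "((\<lambda>r. gauss_weight n r / r) has_real_derivative
           gauss_weight n r * ((real n - 2) / r\<^sup>2 - 1)) (at r)"
proof -
  obtain m where n: "n = Suc m" using assms(1) by (cases n) auto
  have pow: "real m * r ^ (m - 1) = real m * r ^ m / r"
    using assms by (cases m) auto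
  have "((\<lambda>r. r ^ m * exp (- (r\<^sup>2) / 2) / r) has_real_derivative
     ((real m * r ^ (m - 1) * exp (- (r\<^sup>2) / 2) + r ^ m * (exp (- (r\<^sup>2) / 2) * - r)) * r
       - r ^ m * exp (- (r\<^sup>2) / 2)) / (r * r)) (at r)"
    using assms by (auto intro!: derivative_eq_intros)
  then show ?thesis
    unfolding gauss_weight_def n pow using assms
    by (rule_tac DERIV_cong) (auto simp: field_simps power2_eq_square)
qed

lemma measurable_ennreal_indicator:
  assumes "(\<lambda>r. f r * indicator A r :: real) \<in> borel_measurable N"
  shows "(\<lambda>r. ennreal (f r) * indicator A r) \<in> borel_measurable N"
proof -
  have "(\<lambda>r. ennreal (f r) * indicator A r) = (\<lambda>r. ennreal (f r * indicator A r))"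
    by (auto simp: fun_eq_iff indicator_def)
  then show ?thesis
    using assms by simp
qed

lemma nn_integral_gauss_radial:
  fixes f :: "real \<Rightarrow> ennreal"
  assumes "(\<lambda>r. f r * indicator {0..} r) \<in> borel_measurable borel"
  shows "(\<integral>\<^sup>+r. f r \<partial>gauss_radial_measure n)
    = (\<integral>\<^sup>+r. ennreal (gauss_weight n r) * f r * indicator {0..} r \<partial>lborel)"
proof -
  have "f \<in> borel_measurable (restrict_space lborel {0..})"
    using assms by (subst borel_measurable_restrict_space_iff_ennreal) auto
  then show ?thesis
    unfolding gauss_radial_measure_def gauss_weight_def
    by (subst nn_integral_density) (auto simp: nn_integral_restrict_space intro!: measurable_restrict_space1)
qed

text \<open>
  The polynomial factor is absorbed by \<open>r ^ m \<le> m! exp r\<close>, and \<open>2 * r - r\<^sup>2 / 2 \<le> 2\<close> leaves an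
  integrable exponential.
\<close>

lemma gauss_weight_le:
  assumes "0 \<le> r"
  shows "gauss_weight n r \<le> fact (n - 1) * exp 2 * exp (- r)"
proof -
  have "r ^ (n - 1) /\<^sub>R fact (n - 1) \<le> exp r"
    using sum_le_suminf[OF summable_exp_generic[of r], of "{n - 1}"] assms
    by (simp add: exp_def)
  then have "r ^ (n - 1) \<le> fact (n - 1) * exp r"
    by (simp add: field_simps)
  then have "gauss_weight n r \<le> fact (n - 1) * exp r * exp (- (r\<^sup>2) / 2)"
    unfolding gauss_weight_def by (intro mult_right_mono) auto
  also have "\<dots> = fact (n - 1) * exp (r - r\<^sup>2 / 2)"
    by (simp flip: exp_add)
  also have "\<dots> \<le> fact (n - 1) * exp (2 - r)"
  proof -
    have "0 \<le> (r - 2)\<^sup>2" by simp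
    then have "r - r\<^sup>2 / 2 \<le> 2 - r" by (simp add: power2_eq_square algebra_simps)
    then show ?thesis by simp
  qed
  also have "\<dots> = fact (n - 1) * exp 2 * exp (- r)"
    by (simp flip: exp_add)
  finally show ?thesis .
qed

lemma gauss_radial_measure_finite: "(\<integral>\<^sup>+r. 1 \<partial>gauss_radial_measure n) < \<infinity>"
proof -
  define K :: real where "K = fact (n - 1) * exp 2"
  have "(\<integral>\<^sup>+r. 1 \<partial>gauss_radial_measure n)
      = (\<integral>\<^sup>+r. ennreal (gauss_weight n r) * 1 * indicator {0..} r \<partial>lborel)"
    by (intro nn_integral_gauss_radial) auto
  also have "\<dots> \<le> (\<integral>\<^sup>+r. ennreal (K * exp (- r)) * indicator {0..} r \<partial>lborel)"
    using gauss_weight_le[of _ n]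
    by (intro nn_integral_mono) (auto simp: K_def indicator_def intro!: ennreal_leI)
  also have "\<dots> = ennreal (0 - (- K * exp (- 0)))"
  proof (rule nn_integral_FTC_atLeast[where F = "\<lambda>r. - K * exp (- r)"])
    have "((\<lambda>r::real. exp (- r)) \<longlongrightarrow> 0) at_top"
      by (intro filterlim_compose[OF exp_at_bot] filterlim_uminus_at_bot_at_top)
    then show "((\<lambda>r::real. - K * exp (- r)) \<longlongrightarrow> 0) at_top"
      using tendsto_mult_left[of _ 0 at_top "- K"] by fastforce
  qed (auto simp: K_def intro!: derivative_eq_intros)
  finally show ?thesis by (auto simp: le_less_trans)
qed

section \<open>Integration by parts on an interval\<close>

text \<open>
  Integrating \<open>F' \<le> - g + h\<close> and dropping \<open>F b \<ge> 0\<close>.  The Henstock-Kurzweil integral is used for \<open>F'\<close>: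
  near an exceptional point the derivative may be unbounded, and nothing is known in advance
  about its absolute integrability.
\<close>

lemma nn_integral_le_of_derivative:
  fixes F :: "real \<Rightarrow> real"
  assumes "finite S" "a \<le> b" and "continuous_on {a..b} F"
    and F': "\<And>r. r \<in> {a<..<b} - S \<Longrightarrow> (F has_real_derivative F' r) (at r)"
    and bound: "\<And>r. r \<in> {a<..<b} - S \<Longrightarrow> F' r \<le> - g r + h r"
    and g: "continuous_on {a..b} g" "\<And>r. r \<in> {a..b} \<Longrightarrow> 0 \<le> g r"
    and h: "(\<lambda>r. h r * indicator {a..b} r) \<in> borel_measurable borel"
           "\<And>r. r \<in> {a..b} \<Longrightarrow> 0 \<le> h r"
    and "0 \<le> F b" "0 \<le> F a"
  shows "(\<integral>\<^sup>+r. ennreal (g r) * indicator {a..b} r \<partial>lborel)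
    \<le> ennreal (F a) + (\<integral>\<^sup>+r. ennreal (h r) * indicator {a..b} r \<partial>lborel)"
proof (cases "(\<integral>\<^sup>+r. ennreal (h r) * indicator {a..b} r \<partial>lborel) = top")
  case False
  then obtain H where H: "0 \<le> H" "(\<integral>\<^sup>+r. ennreal (h r) * indicator {a..b} r \<partial>lborel) = ennreal H"
    by (metis ennreal_cases infinity_ennreal_def)
  have "((\<lambda>r. h r * indicator {a..b} r) has_integral H) UNIV"
    using h H(1) H(2)[unfolded nn_integral_set_ennreal]
    by (intro nn_integral_has_integral) (auto simp: indicator_def)
  then have h_int: "(h has_integral H) {a..b}"
    using has_integral_restrict_UNIV[of "{a..b}" h H]
    by (simp add: indicator_def of_bool_def if_distrib cong: if_cong)
  \<comment> \<open>The value \<open>- g r\<close> at the exceptional points makes \<open>f + g \<le> h\<close> hold everywhere.\<close>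
  define f where "f r = (if r \<in> S \<union> {a, b} then - g r else F' r)" for r
  have f_int: "(f has_integral F b - F a) {a..b}"
    by (rule fundamental_theorem_of_calculus_interior_strong[where S = "S \<union> {a, b}"])
       (use assms in \<open>auto simp: f_def simp flip: has_real_derivative_iff_has_vector_derivative\<close>)
  have g_int: "(g has_integral integral {a..b} g) {a..b}"
    using g by (intro integrable_integral integrable_continuous_real)
  have "F b - F a + integral {a..b} g \<le> H"
  proof (rule has_integral_le[OF has_integral_add[OF f_int g_int] h_int])
    show "f r + g r \<le> h r" if "r \<in> {a..b}" for r
      using bound[of r] h(2)[of r] that by (auto simp: f_def)
  qed
  then have "ennreal (integral {a..b} g) \<le> ennreal (F a + H)"
    using \<open>0 \<le> F b\<close> by (intro ennreal_leI) linarith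
  then show ?thesis
    using H \<open>0 \<le> F a\<close> nn_integral_has_integral_lebesgue'[OF g(2) g_int] by (simp add: ennreal_plus)
qed simp

lemma nn_integral_atLeast_le:
  fixes f :: "real \<Rightarrow> ennreal"
  assumes [measurable]: "f \<in> borel_measurable borel"
    and "\<And>k::nat. (\<integral>\<^sup>+r. f r * indicator {a..a + real k} r \<partial>lborel) \<le> T"
  shows "(\<integral>\<^sup>+r. f r * indicator {a..} r \<partial>lborel) \<le> T"
proof -
  have "(\<Union>k::nat. {a..a + real k}) = {a..}"
    by (auto, metis add.commute diff_le_eq real_arch_simple)
  then have "(\<integral>\<^sup>+r. f r * indicator {a..} r \<partial>lborel) = emeasure (density lborel f) (\<Union>k::nat. {a..a + real k})"
    by (simp add: emeasure_density)
  also have "\<dots> = (SUP k::nat. emeasure (density lborel f) {a..a + real k})"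
    by (intro SUP_emeasure_incseq[symmetric]) (auto simp: incseq_def)
  also have "\<dots> \<le> T"
    using assms by (intro SUP_least) (simp add: emeasure_density)
  finally show ?thesis .
qed

context doubling_young_function
begin

text \<open>
  The left-hand side is the derivative of \<open>N (r v) w / r\<close> divided by \<open>w\<close>, where \<open>N\<close> is the running
  mean and \<open>w\<close> the weight.  Its main term is \<open>- N (r v) \<le> - \<kappa> M (r v)\<close>; the terms of order
  \<open>1 / r\<^sup>2\<close> and the part of the \<open>v'\<close> term that Young's inequality leaves on \<open>M (r v)\<close> cost \<open>\<kappa> / 4\<close> each,
  so that half of the main term survives.
\<close>

lemma energy_bound:
  assumes n: "1 \<le> n" and r: "tail_radius D n \<le> r"
    and v: "0 < v" and p: "\<bar>v'\<bar> \<le> p"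
  shows "(M (r * v) - average (r * v)) / (r * v) * (v + r * v') / r
      + average (r * v) * ((real n - 2) / r\<^sup>2 - 1) \<le> - (\<kappa> / 2) * M (r * v) + young_const D * M p"
proof -
  define A where "A = average (r * v)"
  define x where "x = M (r * v)"
  define \<delta> where "\<delta> = \<kappa> / 4"
  note \<kappa> = average_const_pos[of D] average_const_le_1[OF exponent_pos]
  note rad = tail_radius_ge[OF exponent_pos, of n]
  then have r0: "1 \<le> r" using r by simp
  have A: "\<kappa> * x \<le> A" "A \<le> x" "0 \<le> A" "0 \<le> x"
    using average_ge[of "r * v"] average_le[of "r * v"] average_nonneg[of "r * v"] v r0
    by (auto simp: A_def x_def intro!: nonneg)
  have "(real n + 1) / r\<^sup>2 \<le> (real n + 1) / tail_radius D n"
  proof -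
    have "tail_radius D n \<le> r * 1" using r by simp
    also have "\<dots> \<le> r * r" using r0 by (intro mult_left_mono) auto
    finally have "tail_radius D n \<le> r\<^sup>2" by (simp add: power2_eq_square)
    then show ?thesis using rad r0 by (intro divide_left_mono mult_pos_pos) auto
  qed
  also have "\<dots> = \<delta>"
  proof -
    have "m / (4 * m / \<kappa>) = \<kappa> / 4" if "0 < m" for m
      using that by simp
    from this[of "real n + 1"] show ?thesis
      by (simp add: tail_radius_def \<delta>_def)
  qed
  finally have small: "(real n + 1) / r\<^sup>2 \<le> \<delta>" .
  have "(x - A) + A * (real n - 2) \<le> x * (real n + 1)"
  proof -
    have "A * real n \<le> x * real n" using A by (intro mult_right_mono) auto
    with A show ?thesis by (simp add: algebra_simps)
  qed
  then have "((x - A) + A * (real n - 2)) / r\<^sup>2 \<le> x * (real n + 1) / r\<^sup>2"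
    by (intro divide_right_mono) auto
  also have "\<dots> \<le> x * \<delta>"
    using mult_left_mono[OF small, of x] A by simp
  finally have 1: "((x - A) + A * (real n - 2)) / r\<^sup>2 \<le> x * \<delta>" .
  have "(x - A) * v' / (r * v) \<le> x * p / (r * v)"
  proof -
    have "(x - A) * v' \<le> (x - A) * p" using A p by (intro mult_left_mono) auto
    also have "\<dots> \<le> x * p" using A p by (intro mult_right_mono) auto
    finally show ?thesis using v r0 by (intro divide_right_mono) auto
  qed
  also have "\<dots> \<le> \<delta> * x + \<delta> * (1 / \<delta>) powr D * M p"
    using young_inequality[of \<delta> "r * v" p] \<kappa> v r0 p unfolding x_def \<delta>_def by auto
  also have "\<delta> * (1 / \<delta>) powr D = young_const D"
    by (simp add: \<delta>_def young_const_def)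
  finally have 2: "(x - A) * v' / (r * v) \<le> \<delta> * x + young_const D * M p" .
  have "(x - A) / (r * v) * (v + r * v') / r + A * ((real n - 2) / r\<^sup>2 - 1)
     = ((x - A) + A * (real n - 2)) / r\<^sup>2 + (x - A) * v' / (r * v) - A"
    using v r0 by (simp add: field_simps power2_eq_square)
  also have "\<dots> \<le> 2 * \<delta> * x + young_const D * M p - \<kappa> * x"
    using 1 2 A by (simp add: algebra_simps)
  also have "\<dots> = - (\<kappa> / 2) * x + young_const D * M p"
    by (simp add: \<delta>_def algebra_simps)
  finally show ?thesis
    unfolding A_def x_def .
qed

lemma weighted_estimate_interval:
  assumes n: "1 \<le> n" and a: "tail_radius D n \<le> a" "a \<le> b"
    and v: "continuous_on {a..b} v" "\<And>r. r \<in> {a..b} \<Longrightarrow> 0 < v r"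
    and S: "finite S" "\<And>r. r \<in> {a<..<b} - S \<Longrightarrow> (v has_real_derivative v' r) (at r)"
    and p: "\<And>r. r \<in> {a<..<b} - S \<Longrightarrow> \<bar>v' r\<bar> \<le> p r" "\<And>r. r \<in> {a..b} \<Longrightarrow> 0 \<le> p r"
      "(\<lambda>r. gauss_weight n r * M (p r) * indicator {a..b} r) \<in> borel_measurable borel"
  shows "ennreal (\<kappa> / 2) * (\<integral>\<^sup>+r. ennreal (gauss_weight n r * M (r * v r)) * indicator {a..b} r \<partial>lborel)
    \<le> ennreal (gauss_weight n a * M (a * v a))
      + ennreal (young_const D) * (\<integral>\<^sup>+r. ennreal (gauss_weight n r * M (p r)) * indicator {a..b} r \<partial>lborel)"
proof -
  let ?w = "gauss_weight n"
  define F where "F r = average (r * v r) * (?w r / r)" for r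
  define F' where "F' r = ?w r * ((M (r * v r) - average (r * v r)) / (r * v r) * (v r + r * v' r) / r
      + average (r * v r) * ((real n - 2) / r\<^sup>2 - 1))" for r
  note \<kappa> = average_const_pos[of D] average_const_le_1[OF exponent_pos]
  have a1: "1 \<le> a"
    using tail_radius_ge[OF exponent_pos, of n] a by simp
  have C: "0 \<le> young_const D"
    using \<kappa> by (simp add: young_const_def)
  have w_cont: "continuous_on {a..b} ?w"
    unfolding gauss_weight_def[abs_def] by (intro continuous_intros) auto
  have rv_cont: "continuous_on {a..b} (\<lambda>r. r * v r)"
    by (intro continuous_intros v)
  have rv_pos: "0 < r * v r" if "r \<in> {a..b}" for r
    using v(2)[OF that] that a1 by auto
  have Mrv_cont: "continuous_on {a..b} (\<lambda>r. M (r * v r))"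
    by (rule continuous_on_compose2[OF continuous rv_cont]) (use rv_pos in \<open>auto intro: less_imp_le\<close>)
  have av_cont: "continuous_on {0<..} average"
    using average_deriv by (intro continuous_at_imp_continuous_on) (auto intro: DERIV_isCont)
  have nonneg_w: "0 \<le> ?w r" if "r \<in> {a..b}" for r
    using that a1 by (auto intro: gauss_weight_nonneg)
  have F_nonneg: "0 \<le> F r" if "r \<in> {a..b}" for r
    unfolding F_def using that a1 average_nonneg[OF rv_pos[OF that]] nonneg_w[OF that] by auto
  have parts: "(\<integral>\<^sup>+r. ennreal (\<kappa> / 2 * (?w r * M (r * v r))) * indicator {a..b} r \<partial>lborel)
    \<le> ennreal (F a) + (\<integral>\<^sup>+r. ennreal (young_const D * (?w r * M (p r))) * indicator {a..b} r \<partial>lborel)"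
  proof (rule nn_integral_le_of_derivative[OF S(1) a(2)])
    show "continuous_on {a..b} F"
      unfolding F_def[abs_def]
      by (intro continuous_intros w_cont continuous_on_compose2[OF av_cont rv_cont]) (use rv_pos a1 in auto)
    show "(F has_real_derivative F' r) (at r)" if "r \<in> {a<..<b} - S" for r
    proof -
      have r: "0 < r" "0 < r * v r" "0 < v r" using that a1 rv_pos[of r] v(2)[of r] by auto
      have "((\<lambda>r. r * v r) has_real_derivative v r + r * v' r) (at r)"
        using S(2)[OF that] by (auto intro!: derivative_eq_intros)
      from DERIV_mult[OF DERIV_chain2[OF average_deriv[OF r(2)] this] gauss_weight_deriv[OF n r(1)]]
      show ?thesis
        unfolding F_def[abs_def] F'_def
        by (rule DERIV_cong) (use r in \<open>simp add: field_simps\<close>)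
    qed
    show "F' r \<le> - (\<kappa> / 2 * (?w r * M (r * v r))) + young_const D * (?w r * M (p r))"
      if "r \<in> {a<..<b} - S" for r
    proof -
      have "F' r \<le> ?w r * (- (\<kappa> / 2) * M (r * v r) + young_const D * M (p r))"
        unfolding F'_def
        by (intro mult_left_mono energy_bound n) (use that a v p nonneg_w in auto)
      then show ?thesis by (simp add: algebra_simps)
    qed
    show "continuous_on {a..b} (\<lambda>r. \<kappa> / 2 * (?w r * M (r * v r)))"
      by (intro continuous_intros w_cont Mrv_cont)
    show "0 \<le> \<kappa> / 2 * (?w r * M (r * v r))" if "r \<in> {a..b}" for r
      using \<kappa> nonneg_w[OF that] nonneg[of "r * v r"] rv_pos[OF that] by auto
    show "(\<lambda>r. young_const D * (?w r * M (p r)) * indicator {a..b} r) \<in> borel_measurable borel"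
      using borel_measurable_times[OF borel_measurable_const p(3), of "young_const D"] by (simp add: mult.assoc)
    show "0 \<le> young_const D * (?w r * M (p r))" if "r \<in> {a..b}" for r
      using C nonneg_w[OF that] nonneg[OF p(2)[OF that]] by auto
  qed (use F_nonneg a in auto)
  have F_a: "F a \<le> ?w a * M (a * v a)"
  proof -
    have "F a \<le> M (a * v a) * (?w a / 1)"
      unfolding F_def using average_le[OF rv_pos] average_nonneg[OF rv_pos] a a1 nonneg_w[of a] nonneg[of "a * v a"] rv_pos[of a]
      by (intro mult_mono divide_left_mono) auto
    then show ?thesis by (simp add: mult.commute)
  qed
  have cmult: "(\<integral>\<^sup>+r. ennreal (c * f r) * indicator {a..b} r \<partial>lborel)
      = ennreal c * (\<integral>\<^sup>+r. ennreal (f r) * indicator {a..b} r \<partial>lborel)"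
    if "0 \<le> c" "(\<lambda>r. f r * indicator {a..b} r) \<in> borel_measurable borel" for c and f :: "real \<Rightarrow> real"
    using that unfolding nn_integral_set_ennreal
    by (subst nn_integral_cmult[symmetric]) (auto simp: ennreal_mult' mult.assoc)
  have meas: "(\<lambda>r. ?w r * M (r * v r) * indicator {a..b} r) \<in> borel_measurable borel"
    using borel_measurable_continuous_on_indicator[of "{a..b}", OF _ continuous_on_mult[OF w_cont Mrv_cont]]
    by (simp add: mult.commute)
  have "0 \<le> \<kappa> / 2" using \<kappa> by simp
  from parts show ?thesis
    unfolding cmult[OF \<open>0 \<le> \<kappa> / 2\<close> meas] cmult[OF C p(3)]
    by (rule order_trans) (intro add_right_mono ennreal_leI F_a)
qed

text \<open>
  The tail starts at a point \<open>a\<close> between the tail radius \<open>R\<close> and \<open>R + 1\<close>.  Up to \<open>R + 1\<close> the factor \<open>r\<close> is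
  bounded and the growth condition suffices; beyond \<open>a\<close> the interval estimates are uniform in the right end
  point.
\<close>

lemma weighted_estimate_halfline:
  assumes n: "1 \<le> n"
    and v: "continuous_on {0..} v" "\<And>r. 0 \<le> r \<Longrightarrow> 0 < v r"
    and v': "\<And>R. 0 < R \<Longrightarrow> \<exists>S. finite S \<and> (\<forall>r \<in> {0<..<R} - S. (v has_real_derivative v' r) (at r) \<and> \<bar>v' r\<bar> \<le> p r)"
    and p: "\<And>r. 0 \<le> p r" "(\<lambda>r. gauss_weight n r * M (p r) * indicator {0..} r) \<in> borel_measurable borel"
  defines "K \<equiv> (tail_radius D n + 1) powr D"
  defines "X \<equiv> (\<integral>\<^sup>+r. ennreal (gauss_weight n r * M (v r)) * indicator {0..} r \<partial>lborel)"
  defines "Y \<equiv> (\<integral>\<^sup>+r. ennreal (gauss_weight n r * M (p r)) * indicator {0..} r \<partial>lborel)"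
  shows "(\<integral>\<^sup>+r. ennreal (gauss_weight n r * M (r * v r)) * indicator {0..} r \<partial>lborel)
    \<le> ennreal (K * (1 + 2 / \<kappa>)) * X + ennreal (2 / \<kappa> * young_const D) * Y"
proof -
  let ?w = "gauss_weight n" and ?R = "tail_radius D n"
  define \<phi> where "\<phi> r = ?w r * M (r * v r)" for r
  note \<kappa> = average_const_pos[of D] average_const_le_1[OF exponent_pos]
  note R = tail_radius_ge[OF exponent_pos, of n]
  have C: "0 \<le> young_const D"
    using \<kappa> by (simp add: young_const_def)
  have w_cont: "continuous_on A ?w" for A
    unfolding gauss_weight_def[abs_def] by (intro continuous_intros) auto
  have v_nonneg: "0 \<le> v r" if "0 \<le> r" for r
    using v(2)[OF that] by simp
  have Mv_cont: "continuous_on {0..} (\<lambda>r. M (v r))"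
    by (rule continuous_on_compose2[OF continuous v(1)]) (auto simp: v_nonneg)
  have "continuous_on {0..} (\<lambda>r. M (r * v r))"
    by (rule continuous_on_compose2[OF continuous continuous_on_mult[OF continuous_on_id v(1)]])
       (auto simp: v_nonneg)
  then have \<phi>_cont: "continuous_on {0..} \<phi>"
    unfolding \<phi>_def[abs_def] by (intro continuous_intros w_cont)
  have \<phi>_meas: "(\<lambda>r. ennreal (\<phi> r) * indicator {0..} r) \<in> borel_measurable borel"
    using borel_measurable_continuous_on_indicator[OF _ \<phi>_cont]
    by (intro measurable_ennreal_indicator) (simp add: mult.commute)
  have wMv_meas: "(\<lambda>r. ennreal (?w r * M (v r)) * indicator {0..} r) \<in> borel_measurable borel"
    using borel_measurable_continuous_on_indicator[OF _ continuous_on_mult[OF w_cont Mv_cont]]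
    by (intro measurable_ennreal_indicator) (simp add: mult.commute)
  have near: "(\<integral>\<^sup>+r. ennreal (\<phi> r) * indicator {c..d} r \<partial>lborel) \<le> ennreal K * X"
    if "0 \<le> c" "d \<le> ?R + 1" for c d
  proof -
    have "\<phi> r \<le> K * (?w r * M (v r))" if "0 \<le> r" "r \<le> ?R + 1" for r
    proof -
      have "M (r * v r) \<le> M ((?R + 1) * v r)"
        using that v(2)[of r] by (intro le mult_right_mono) auto
      also have "\<dots> \<le> K * M (v r)"
        unfolding K_def using R v(2)[of r] that by (intro growth) auto
      finally show ?thesis
        using mult_left_mono[of "M (r * v r)" _ "?w r"] gauss_weight_nonneg[of r n] that
        unfolding \<phi>_def by (metis mult.left_commute)
    qed
    then have "(\<integral>\<^sup>+r. ennreal (\<phi> r) * indicator {c..d} r \<partial>lborel)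
      \<le> (\<integral>\<^sup>+r. ennreal K * (ennreal (?w r * M (v r)) * indicator {0..} r) \<partial>lborel)"
      using that
      by (intro nn_integral_mono)
         (auto simp: indicator_def K_def simp flip: ennreal_mult' intro!: ennreal_leI)
    also have "\<dots> = ennreal K * X"
      unfolding X_def using wMv_meas by (intro nn_integral_cmult) auto
    finally show ?thesis .
  qed
  \<comment> \<open>At a minimum point \<open>a\<close> of \<open>\<phi>\<close> on an interval of length one, the boundary term \<open>\<phi> a\<close> is at most the
    integral of \<open>\<phi>\<close> over that interval.\<close>
  obtain a where a: "?R \<le> a" "a \<le> ?R + 1" and min: "\<And>r. r \<in> {?R..?R + 1} \<Longrightarrow> \<phi> a \<le> \<phi> r"
    using continuous_attains_inf[of "{?R..?R + 1}" \<phi>] continuous_on_subset[OF \<phi>_cont, of "{?R..?R + 1}"] R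
    by auto
  have "ennreal (\<phi> a) = (\<integral>\<^sup>+r. ennreal (\<phi> a) * indicator {?R..?R + 1} r \<partial>lborel)"
    by (simp add: nn_integral_cmult_indicator)
  also have "\<dots> \<le> (\<integral>\<^sup>+r. ennreal (\<phi> r) * indicator {?R..?R + 1} r \<partial>lborel)"
    using min by (intro nn_integral_mono) (auto simp: indicator_def intro!: ennreal_leI)
  also have "\<dots> \<le> ennreal K * X"
    using R by (intro near) auto
  finally have boundary: "ennreal (\<phi> a) \<le> ennreal K * X" .
  define T where "T = ennreal K * X + ennreal (young_const D) * Y"
  have far: "(\<integral>\<^sup>+r. ennreal (\<phi> r) * indicator {a..a + real k} r \<partial>lborel) \<le> ennreal (2 / \<kappa>) * T"
    (is "?Z \<le> _") for k :: nat
  proof -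
    obtain S where S: "finite S"
      "\<forall>r \<in> {0<..<a + real k} - S. (v has_real_derivative v' r) (at r) \<and> \<bar>v' r\<bar> \<le> p r"
      using v'[of "a + real k"] a R by auto
    have "(\<lambda>r. ?w r * M (p r) * indicator {0..} r * indicator {a..a + real k} r) \<in> borel_measurable borel"
      by (rule borel_measurable_times[OF p(2)]) simp
    also have "(\<lambda>r. ?w r * M (p r) * indicator {0..} r * indicator {a..a + real k} r)
        = (\<lambda>r. ?w r * M (p r) * indicator {a..a + real k} r)"
      using a R by (auto simp: fun_eq_iff indicator_def)
    finally have meas: "(\<lambda>r. ?w r * M (p r) * indicator {a..a + real k} r) \<in> borel_measurable borel" .
    have "ennreal (\<kappa> / 2) * ?Z \<le> ennreal (\<phi> a)
      + ennreal (young_const D) * (\<integral>\<^sup>+r. ennreal (?w r * M (p r)) * indicator {a..a + real k} r \<partial>lborel)"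
      unfolding \<phi>_def
    proof (rule weighted_estimate_interval[OF n a(1) _ _ _ S(1) _ _ _ meas])
      show "continuous_on {a..a + real k} v"
        using continuous_on_subset[OF v(1)] a R by auto
    qed (use S v(2) a R p in auto)
    also have "\<dots> \<le> T"
      unfolding T_def Y_def using a R
      by (intro add_mono boundary mult_left_mono nn_integral_mono) (auto simp: indicator_def)
    finally have "ennreal (2 / \<kappa>) * (ennreal (\<kappa> / 2) * ?Z) \<le> ennreal (2 / \<kappa>) * T"
      by (rule mult_left_mono) auto
    moreover have "ennreal (2 / \<kappa>) * (ennreal (\<kappa> / 2) * ?Z) = ?Z"
      using \<kappa> by (simp flip: mult.assoc ennreal_mult')
    ultimately show ?thesis by simp
  qed
  have tail: "(\<integral>\<^sup>+r. ennreal (\<phi> r) * indicator {0..} r * indicator {a..} r \<partial>lborel) \<le> ennreal (2 / \<kappa>) * T"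
  proof (rule nn_integral_atLeast_le[OF \<phi>_meas])
    fix k :: nat
    have "(\<integral>\<^sup>+r. ennreal (\<phi> r) * indicator {0..} r * indicator {a..a + real k} r \<partial>lborel)
        = (\<integral>\<^sup>+r. ennreal (\<phi> r) * indicator {a..a + real k} r \<partial>lborel)"
      using a R by (intro nn_integral_cong) (auto simp: indicator_def)
    then show "(\<integral>\<^sup>+r. ennreal (\<phi> r) * indicator {0..} r * indicator {a..a + real k} r \<partial>lborel)
        \<le> ennreal (2 / \<kappa>) * T"
      using far[of k] by simp
  qed
  have "(\<integral>\<^sup>+r. ennreal (\<phi> r) * indicator {0..} r \<partial>lborel)
    \<le> (\<integral>\<^sup>+r. ennreal (\<phi> r) * indicator {0..} r * indicator {0..a} r
        + ennreal (\<phi> r) * indicator {0..} r * indicator {a..} r \<partial>lborel)"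
    using a R by (intro nn_integral_mono) (auto simp: indicator_def)
  also have "\<dots> = (\<integral>\<^sup>+r. ennreal (\<phi> r) * indicator {0..} r * indicator {0..a} r \<partial>lborel)
      + (\<integral>\<^sup>+r. ennreal (\<phi> r) * indicator {0..} r * indicator {a..} r \<partial>lborel)"
    using \<phi>_meas by (intro nn_integral_add) (auto intro!: borel_measurable_times_ennreal)
  also have "(\<integral>\<^sup>+r. ennreal (\<phi> r) * indicator {0..} r * indicator {0..a} r \<partial>lborel)
      = (\<integral>\<^sup>+r. ennreal (\<phi> r) * indicator {0..a} r \<partial>lborel)"
    by (intro nn_integral_cong) (auto simp: indicator_def)
  also have "\<dots> + (\<integral>\<^sup>+r. ennreal (\<phi> r) * indicator {0..} r * indicator {a..} r \<partial>lborel)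
      \<le> ennreal K * X + ennreal (2 / \<kappa>) * T"
    using near[of 0 a] a tail by (intro add_mono) auto
  also have "\<dots> = ennreal (K * (1 + 2 / \<kappa>)) * X + ennreal (2 / \<kappa> * young_const D) * Y"
  proof -
    have "ennreal (K * (1 + 2 / \<kappa>)) = ennreal (K + 2 / \<kappa> * K)"
      by (simp add: algebra_simps)
    also have "\<dots> = ennreal K + ennreal (2 / \<kappa>) * ennreal K"
      using \<kappa> by (simp only: ennreal_mult'[symmetric] ennreal_plus[symmetric] K_def powr_ge_zero
          divide_nonneg_nonneg mult_nonneg_nonneg less_imp_le zero_le_numeral)
    finally have "ennreal (K * (1 + 2 / \<kappa>)) = ennreal K + ennreal (2 / \<kappa>) * ennreal K" .
    moreover have "ennreal (2 / \<kappa> * young_const D) = ennreal (2 / \<kappa>) * ennreal (young_const D)"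
      using \<kappa> C by (intro ennreal_mult) auto
    ultimately show ?thesis
      unfolding T_def by (simp only: distrib_left distrib_right mult.assoc add.assoc)
  qed
  finally show ?thesis
    unfolding \<phi>_def .
qed

end

section \<open>Removing the positivity assumption\<close>

lemma piecewise_C1_halfline_deriv:
  assumes "piecewise_C1_halfline u" "0 < R"
  obtains S where "finite S" "\<And>r. r \<in> {0..R} - S \<Longrightarrow> (u has_real_derivative deriv u r) (at r)"
    "continuous_on ({0..R} - S) (deriv u)"
proof -
  obtain S D where S: "finite S" and D: "\<And>r. r \<in> {0..R} - S \<Longrightarrow> (u has_vector_derivative D r) (at r)"
    and cont: "continuous_on ({0..R} - S) D"
  proof -
    have "\<exists>S. finite S \<and> u C1_differentiable_on ({0..R} - S)"
      using assms by (auto simp: piecewise_C1_halfline_def piecewise_C1_differentiable_on_def)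
    then show ?thesis
      unfolding C1_differentiable_on_def by (elim exE conjE) (rule that, auto)
  qed
  have u': "(u has_real_derivative D r) (at r)" if "r \<in> {0..R} - S" for r
    using D[OF that] by (simp add: has_real_derivative_iff_has_vector_derivative)
  then have eq: "deriv u r = D r" if "r \<in> {0..R} - S" for r
    using that by (auto intro: DERIV_imp_deriv)
  have "continuous_on ({0..R} - S) (deriv u)"
    using cont eq by (subst continuous_on_cong[OF refl eq]) auto
  with S u' eq show ?thesis
    by (intro that[of S]) auto
qed

text \<open>
  The break points on different bounded intervals are not assumed to be compatible, but all of
  them together form a countable set, and off that set \<open>deriv u\<close> is a pointwise limit of
  functions each continuous on a Borel set and zero outside it.
\<close>

lemma piecewise_C1_halfline_measurable_deriv:
  assumes "piecewise_C1_halfline u"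
  shows "(\<lambda>r. deriv u r * indicator {0..} r) \<in> borel_measurable borel"
proof -
  have "\<exists>S. finite S \<and> continuous_on ({0..real k + 1} - S) (deriv u)" for k
    by (rule piecewise_C1_halfline_deriv[OF assms, of "real k + 1"]) auto
  then obtain S where S: "\<And>k. finite (S k)" "\<And>k. continuous_on ({0..real k + 1} - S k) (deriv u)"
    by metis
  define T where "T = (\<Union>k. S k)"
  have T: "countable T"
    using S(1) by (simp add: T_def countable_finite)
  then have T_borel: "T \<in> sets borel"
    by (rule sets.countable[rotated]) simp
  have "(\<lambda>r. deriv u r * indicator ({0..} - T) r) \<in> borel_measurable borel"
  proof (rule borel_measurable_LIMSEQ_real)
    show "(\<lambda>r. deriv u r * indicator ({0..real k + 1} - T) r) \<in> borel_measurable borel" for k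
    proof -
      have "continuous_on ({0..real k + 1} - T) (deriv u)"
        by (rule continuous_on_subset[OF S(2)[of k]]) (auto simp: T_def)
      then show ?thesis
        using borel_measurable_continuous_on_indicator[of "{0..real k + 1} - T" "deriv u"] T_borel
        by (simp add: mult.commute)
    qed
    show "(\<lambda>k. deriv u r * indicator ({0..real k + 1} - T) r)
        \<longlonglongrightarrow> deriv u r * indicator ({0..} - T) r" for r
    proof (rule tendsto_eventually)
      obtain m :: nat where "r \<le> real m" using real_arch_simple by blast
      then show "\<forall>\<^sub>F k in sequentially. deriv u r * indicator ({0..real k + 1} - T) r
          = deriv u r * indicator ({0..} - T) r"
        by (intro eventually_sequentiallyI[of m]) (auto simp: indicator_def)
    qed
  qed
  then show ?thesis
    by (rule measurable_discrete_difference[OF _ T]) (auto simp: indicator_def)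
qed


lemma sqrt_sum_squares_deriv:
  fixes u :: "real \<Rightarrow> real"
  assumes "(u has_real_derivative u') (at r)" and "\<epsilon> \<noteq> 0"
  shows "((\<lambda>r. sqrt ((u r)\<^sup>2 + \<epsilon>\<^sup>2)) has_real_derivative u r * u' / sqrt ((u r)\<^sup>2 + \<epsilon>\<^sup>2)) (at r)"
    and "\<bar>u r * u' / sqrt ((u r)\<^sup>2 + \<epsilon>\<^sup>2)\<bar> \<le> \<bar>u'\<bar>"
proof -
  have pos: "0 < (u r)\<^sup>2 + \<epsilon>\<^sup>2"
    using assms(2) by (simp add: add_nonneg_pos)
  show "((\<lambda>r. sqrt ((u r)\<^sup>2 + \<epsilon>\<^sup>2)) has_real_derivative u r * u' / sqrt ((u r)\<^sup>2 + \<epsilon>\<^sup>2)) (at r)"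
    using assms(1) pos by (auto intro!: derivative_eq_intros simp: field_simps)
  have "\<bar>u r\<bar> \<le> sqrt ((u r)\<^sup>2 + \<epsilon>\<^sup>2)"
    by (rule real_sqrt_ge_abs1)
  then have "\<bar>u r\<bar> * \<bar>u'\<bar> \<le> sqrt ((u r)\<^sup>2 + \<epsilon>\<^sup>2) * \<bar>u'\<bar>"
    by (rule mult_right_mono) simp
  then show "\<bar>u r * u' / sqrt ((u r)\<^sup>2 + \<epsilon>\<^sup>2)\<bar> \<le> \<bar>u'\<bar>"
    using pos by (simp add: abs_mult field_simps)
qed

context doubling_young_function
begin

text \<open>
  The estimate for the positive function \<open>v = sqrt (u\<^sup>2 + \<epsilon>\<^sup>2)\<close> is transferred to \<open>u\<close> by
  \<open>\<bar>u\<bar> \<le> v \<le> \<bar>u\<bar> + \<epsilon>\<close>.  The error \<open>M \<epsilon> \<le> \<epsilon> M 1\<close> is integrable because the measure is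
  finite, and it vanishes with \<open>\<epsilon>\<close>.
\<close>

lemma weighted_estimate:
  assumes n: "1 \<le> n" and u: "continuous_on {0..} u" "piecewise_C1_halfline u"
  defines "A \<equiv> (tail_radius D n + 1) powr D * (1 + 2 / \<kappa>)"
  shows "(\<integral>\<^sup>+r. ennreal (M (r * \<bar>u r\<bar>)) \<partial>gauss_radial_measure n)
    \<le> ennreal (A * 2 powr D) * (\<integral>\<^sup>+r. ennreal (M \<bar>u r\<bar>) \<partial>gauss_radial_measure n)
      + ennreal (2 / \<kappa> * young_const D) * (\<integral>\<^sup>+r. ennreal (M \<bar>deriv u r\<bar>) \<partial>gauss_radial_measure n)"
    (is "?L \<le> _ * ?X + ennreal ?B * ?Y")
proof (rule ennreal_le_epsilon)
  fix e :: real
  assume e: "0 < e"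
  let ?w = "gauss_weight n"
  obtain W where W: "0 \<le> W" "(\<integral>\<^sup>+r. 1 \<partial>gauss_radial_measure n) = ennreal W"
    using gauss_radial_measure_finite[of n] by (metis ennreal_cases infinity_ennreal_def less_irrefl)
  have A: "0 \<le> A"
    using average_const_pos[of D] by (simp add: A_def)
  have M1: "0 \<le> M 1" by (simp add: nonneg)
  \<comment> \<open>The error caused by \<open>\<epsilon>\<close> will be \<open>A * 2 powr D * M 1 * W * \<epsilon>\<close>; the summand 1 keeps \<open>q\<close> positive.\<close>
  define q where "q = A * 2 powr D * M 1 * W + 1"
  have q: "0 < q" using A M1 W by (simp add: q_def add_nonneg_pos)
  define \<epsilon> where "\<epsilon> = min 1 (e / q)"
  have \<epsilon>: "0 < \<epsilon>" "\<epsilon> \<le> 1" using e q by (auto simp: \<epsilon>_def)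
  have \<epsilon>_small: "A * 2 powr D * M 1 * W * \<epsilon> \<le> e"
  proof -
    have "A * 2 powr D * M 1 * W * \<epsilon> \<le> q * (e / q)"
      using A M1 W e q \<epsilon> by (intro mult_mono) (auto simp: q_def \<epsilon>_def)
    then show ?thesis using q by simp
  qed
  define v where "v r = sqrt ((u r)\<^sup>2 + \<epsilon>\<^sup>2)" for r
  define v' where "v' r = u r * deriv u r / v r" for r
  have v_pos: "0 < v r" for r
    using \<epsilon> by (simp add: v_def add_nonneg_pos)
  have v_nonneg: "0 \<le> v r" for r
    by (simp add: v_def)
  have v_cont: "continuous_on {0..} v"
    unfolding v_def[abs_def] by (intro continuous_intros u)
  have v_ge: "\<bar>u r\<bar> \<le> v r" for r
    unfolding v_def by (rule real_sqrt_ge_abs1)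
  have v_le: "v r \<le> \<bar>u r\<bar> + \<epsilon>" for r
    unfolding v_def using sqrt_sum_squares_le_sum_abs[of "u r" \<epsilon>] \<epsilon> by simp
  have Mv: "M (v r) \<le> 2 powr D * (M \<bar>u r\<bar> + M 1 * \<epsilon>)" for r
  proof -
    have "M (v r) \<le> 2 powr D * (M \<bar>u r\<bar> + M \<epsilon>)"
      using le[OF v_nonneg[of r] v_le[of r]] add_le[of "\<bar>u r\<bar>" \<epsilon>] \<epsilon> by linarith
    also have "\<dots> \<le> 2 powr D * (M \<bar>u r\<bar> + M 1 * \<epsilon>)"
      using star_shaped[of \<epsilon> 1] \<epsilon> by (intro mult_left_mono add_left_mono) (auto simp: mult.commute)
    finally show ?thesis .
  qed
  have gauss: "(\<integral>\<^sup>+r. ennreal (f r) \<partial>gauss_radial_measure n)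
      = (\<integral>\<^sup>+r. ennreal (?w r * f r) * indicator {0..} r \<partial>lborel)"
    if "(\<lambda>r. f r * indicator {0..} r) \<in> borel_measurable borel" for f
  proof -
    have "(\<integral>\<^sup>+r. ennreal (f r) \<partial>gauss_radial_measure n)
      = (\<integral>\<^sup>+r. ennreal (?w r) * ennreal (f r) * indicator {0..} r \<partial>lborel)"
      using that by (intro nn_integral_gauss_radial measurable_ennreal_indicator)
    also have "\<dots> = (\<integral>\<^sup>+r. ennreal (?w r * f r) * indicator {0..} r \<partial>lborel)"
      by (intro nn_integral_cong) (auto simp: indicator_def ennreal_mult' gauss_weight_nonneg)
    finally show ?thesis .
  qed
  have cont_meas: "(\<lambda>r. f r * indicator {0..} r) \<in> borel_measurable borel"
    if "continuous_on {0..} f" for f :: "real \<Rightarrow> real"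
    using borel_measurable_continuous_on_indicator[OF _ that] by (simp add: mult.commute)
  have Mru_meas: "(\<lambda>r. M \<bar>r * u r\<bar> * indicator {0..} r) \<in> borel_measurable borel"
    by (intro cont_meas continuous_abs continuous_intros u)
  have Mv_meas: "(\<lambda>r. M \<bar>v r\<bar> * indicator {0..} r) \<in> borel_measurable borel"
    by (intro cont_meas continuous_abs v_cont)
  have Mru': "(\<lambda>r. M (r * \<bar>u r\<bar>) * indicator {0..} r) \<in> borel_measurable borel"
    using Mru_meas by (rule measurable_cong[THEN iffD1, rotated]) (auto simp: indicator_def abs_mult)
  have deriv_meas: "(\<lambda>r. M \<bar>deriv u r\<bar> * indicator {0..} r) \<in> borel_measurable borel"
  proof -
    have "(\<lambda>r. M \<bar>deriv u r * indicator {0..} r\<bar>) \<in> borel_measurable borel"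
      by (rule measurable_compose[OF piecewise_C1_halfline_measurable_deriv[OF u(2)] measurable_abs])
    then show ?thesis
      by (rule measurable_cong[THEN iffD1, rotated]) (auto simp: indicator_def zero)
  qed
  have Mv_integral: "(\<integral>\<^sup>+r. ennreal (M (v r)) \<partial>gauss_radial_measure n)
      \<le> ennreal (2 powr D) * (?X + ennreal (M 1 * \<epsilon>) * ennreal W)"
  proof -
    have sets: "sets (gauss_radial_measure n) = sets (restrict_space borel {0..})"
      by (simp add: gauss_radial_measure_def sets_restrict_space)
    have meas: "(\<lambda>r. ennreal (M \<bar>u r\<bar>)) \<in> borel_measurable (gauss_radial_measure n)"
      unfolding measurable_cong_sets[OF sets refl]
      by (intro measurable_compose[OF _ measurable_ennreal] borel_measurable_continuous_on_restrict continuous_abs u)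
    have "(\<integral>\<^sup>+r. ennreal (M (v r)) \<partial>gauss_radial_measure n)
      \<le> (\<integral>\<^sup>+r. ennreal (2 powr D) * (ennreal (M \<bar>u r\<bar>) + ennreal (M 1 * \<epsilon>) * 1) \<partial>gauss_radial_measure n)"
      using Mv M1 \<epsilon> by (intro nn_integral_mono)
        (auto simp: nonneg simp flip: ennreal_plus ennreal_mult' intro!: ennreal_leI)
    also have "\<dots> = ennreal (2 powr D) * (?X + ennreal (M 1 * \<epsilon>) * ennreal W)"
      using meas by (simp add: nn_integral_cmult nn_integral_add flip: W(2))
    finally show ?thesis .
  qed
  have "?L \<le> (\<integral>\<^sup>+r. ennreal (?w r * M (r * v r)) * indicator {0..} r \<partial>lborel)"
    unfolding gauss[OF Mru']
    by (intro nn_integral_mono)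
       (auto simp: indicator_def v_ge gauss_weight_nonneg intro!: ennreal_leI mult_left_mono le)
  also have "\<dots> \<le> ennreal A * (\<integral>\<^sup>+r. ennreal (?w r * M (v r)) * indicator {0..} r \<partial>lborel)
      + ennreal ?B * (\<integral>\<^sup>+r. ennreal (?w r * M \<bar>deriv u r\<bar>) * indicator {0..} r \<partial>lborel)"
    unfolding A_def
  proof (rule weighted_estimate_halfline[OF n v_cont])
    show "\<exists>S. finite S \<and> (\<forall>r \<in> {0<..<R} - S. (v has_real_derivative v' r) (at r) \<and> \<bar>v' r\<bar> \<le> \<bar>deriv u r\<bar>)"
      if R: "0 < R" for R
    proof -
      obtain S where S: "finite S" "\<And>r. r \<in> {0..R} - S \<Longrightarrow> (u has_real_derivative deriv u r) (at r)"
        by (rule piecewise_C1_halfline_deriv[OF u(2) R]) (rule that)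
      have "(v has_real_derivative v' r) (at r) \<and> \<bar>v' r\<bar> \<le> \<bar>deriv u r\<bar>" if "r \<in> {0<..<R} - S" for r
        using sqrt_sum_squares_deriv[OF S(2), of r \<epsilon>] that \<epsilon>
        unfolding v_def[abs_def] v'_def by auto
      with S(1) show ?thesis by blast
    qed
    have "?w \<in> borel_measurable borel"
      unfolding gauss_weight_def[abs_def] by (intro borel_measurable_continuous_onI continuous_intros) auto
    from borel_measurable_times[OF this deriv_meas]
    show "(\<lambda>r. ?w r * M \<bar>deriv u r\<bar> * indicator {0..} r) \<in> borel_measurable borel"
      by (simp add: mult.assoc)
  qed (use v_pos in auto)
  also have "\<dots> = ennreal A * (\<integral>\<^sup>+r. ennreal (M (v r)) \<partial>gauss_radial_measure n) + ennreal ?B * ?Y"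
    using gauss[OF Mv_meas] gauss[OF deriv_meas] v_nonneg by simp
  also have "\<dots> \<le> ennreal A * (ennreal (2 powr D) * (?X + ennreal (M 1 * \<epsilon>) * ennreal W)) + ennreal ?B * ?Y"
    by (intro add_right_mono mult_left_mono Mv_integral) simp
  also have "ennreal A * (ennreal (2 powr D) * (?X + ennreal (M 1 * \<epsilon>) * ennreal W)) + ennreal ?B * ?Y
      = ennreal (A * 2 powr D) * ?X + ennreal ?B * ?Y + ennreal (A * 2 powr D * M 1 * W * \<epsilon>)"
  proof -
    have "A * 2 powr D * M 1 * W * \<epsilon> = A * (2 powr D * (M 1 * \<epsilon> * W))"
      by (simp add: mult_ac)
    also have "ennreal \<dots> = ennreal A * (ennreal (2 powr D) * (ennreal (M 1 * \<epsilon>) * ennreal W))"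
      using A W M1 \<epsilon> by (simp add: ennreal_mult)
    finally have "ennreal (A * 2 powr D * M 1 * W * \<epsilon>)
      = ennreal A * (ennreal (2 powr D) * (ennreal (M 1 * \<epsilon>) * ennreal W))" .
    moreover have "ennreal (A * 2 powr D) = ennreal A * ennreal (2 powr D)"
      using A by (intro ennreal_mult) auto
    ultimately show ?thesis
      by (simp only: distrib_left mult.assoc add.assoc add.commute[of "ennreal ?B * ?Y"])
  qed
  also have "\<dots> \<le> ennreal (A * 2 powr D) * ?X + ennreal ?B * ?Y + ennreal e"
    by (intro add_left_mono ennreal_leI \<epsilon>_small)
  finally show "?L \<le> ennreal (A * 2 powr D) * ?X + ennreal ?B * ?Y + ennreal e" .
qed

end

theorem proposition3p2:
  fixes n :: nat and D\<^sub>M :: real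
  assumes "n \<ge> 1" and "D\<^sub>M > 0"
  shows "\<exists>C\<^sub>1 C\<^sub>2 :: real. C\<^sub>1 \<ge> 0 \<and> C\<^sub>2 \<ge> 0 \<and>
    (\<forall>M :: real \<Rightarrow> real.
       (\<forall>x\<ge>0. M x \<ge> 0) \<longrightarrow> mono_on {0..} M \<longrightarrow> convex_on {0..} M \<longrightarrow> M 0 = 0 \<longrightarrow>
       (\<forall>\<alpha>\<ge>1. \<forall>x\<ge>0. M (\<alpha> * x) \<le> \<alpha> powr D\<^sub>M * M x) \<longrightarrow>
       (\<forall>u :: real \<Rightarrow> real. continuous_on {0..} u \<longrightarrow> piecewise_C1_halfline u \<longrightarrow>
          (\<integral>\<^sup>+r. ennreal (M (r * \<bar>u r\<bar>)) \<partial>gauss_radial_measure n)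
          \<le> ennreal C\<^sub>1 * (\<integral>\<^sup>+r. ennreal (M \<bar>u r\<bar>) \<partial>gauss_radial_measure n)
            + ennreal C\<^sub>2 * (\<integral>\<^sup>+r. ennreal (M \<bar>deriv u r\<bar>) \<partial>gauss_radial_measure n)))"
proof (intro exI conjI allI impI)
  note pos = average_const_pos[of D\<^sub>M]
  show "0 \<le> (tail_radius D\<^sub>M n + 1) powr D\<^sub>M * (1 + 2 / average_const D\<^sub>M) * 2 powr D\<^sub>M"
    using pos by simp
  show "0 \<le> 2 / average_const D\<^sub>M * young_const D\<^sub>M"
    using pos by (simp add: young_const_def)
  fix M u :: "real \<Rightarrow> real"
  assume M: "\<forall>x\<ge>0. M x \<ge> 0" "mono_on {0..} M" "convex_on {0..} M" "M 0 = 0"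
      "\<forall>\<alpha>\<ge>1. \<forall>x\<ge>0. M (\<alpha> * x) \<le> \<alpha> powr D\<^sub>M * M x"
    and u: "continuous_on {0..} u" "piecewise_C1_halfline u"
  interpret doubling_young_function M D\<^sub>M
    by unfold_locales (use M assms in blast)+
  show "(\<integral>\<^sup>+r. ennreal (M (r * \<bar>u r\<bar>)) \<partial>gauss_radial_measure n)
      \<le> ennreal ((tail_radius D\<^sub>M n + 1) powr D\<^sub>M * (1 + 2 / average_const D\<^sub>M) * 2 powr D\<^sub>M)
          * (\<integral>\<^sup>+r. ennreal (M \<bar>u r\<bar>) \<partial>gauss_radial_measure n)
        + ennreal (2 / average_const D\<^sub>M * young_const D\<^sub>M)
          * (\<integral>\<^sup>+r. ennreal (M \<bar>deriv u r\<bar>) \<partial>gauss_radial_measure n)"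
    by (rule weighted_estimate[OF assms(1) u])
qed

end
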